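(* Let $\mathbb{F}$ be any field. Up to isomorphism, the only nonabelian anticommutative algebra of dimension $2$ over $\mathbb{F}$ is the affine Lie algebra $\mathfrak{aff}(\mathbb{F})$. Moreover, $\mathfrak{aff}(\mathbb{F})$ can be endowed with the structure of a simple Hom-Lie algebra: for every twisting map $\sigma$ of $\mathfrak{aff}(\mathbb{F})$ that does not leave invariant the unique one-dimensional ideal $I$ of $\mathfrak{aff}(\mathbb{F})$ (that is, $\sigma(I)\not\subset I$), the triple $(\mathfrak{aff}(\mathbb{F}),[\cdot,\cdot],\sigma)$ is a simple Hom-Lie algebra.
   Context: An anticommutative algebra over $\mathbb{F}$ is a vector space $A$ with a bilinear product $[\cdot,\cdot]$ such that $[x,x]=0$ for all $x\in A$; it is abelian if the product is zero. The affine Lie algebra $\mathfrak{aff}(\mathbb{F})$ has basis $\{x,y\}$ with $[x,y]=y$; its unique one-dimensional ideal is $\mathbb{F}y$. A Hom-Lie algebra is a triple $(A,[\cdot,\cdot],\sigma)$ where $(A,[\cdot,\cdot])$ is an anticommutative algebra and $\sigma:A\to A$ is a linear map satisfying the Hom-Jacobi identity $[\sigma(x),[y,z]]+[\sigma(y),[z,x]]+[\sigma(z),[x,y]]=0$ for all $x,y,z\in A$; such a $\sigma$ is called a twisting map of $A$. A Hom-ideal of a Hom-Lie algebra is a subspace $I$ with $[I,A]\subset I$ and $\sigma(I)\subset I$. A Hom-Lie algebra is simple if it is not abelian and its only Hom-ideals are $0$ and $A$. *)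

theory Defs
  imports Complex_Main "HOL-Library.Product_Plus"
begin

text \<open>As in the library locale \<^locale>\<open>vector_space\<close>, the underlying vector space is a whole
  type \<open>'a\<close>, with an explicit scalar multiplication by elements of an arbitrary field \<open>'f\<close>.\<close>

locale anticommutative_algebra = vector_space scale
  for scale :: "'f::field \<Rightarrow> 'a::ab_group_add \<Rightarrow> 'a" +
  fixes bracket :: "'a \<Rightarrow> 'a \<Rightarrow> 'a"
  assumes linear_bracket_right: "Vector_Spaces.linear scale scale (\<lambda>y. bracket x y)"
    and linear_bracket_left: "Vector_Spaces.linear scale scale (\<lambda>x. bracket x y)"
    and bracket_self: "bracket x x = 0"

definition abelian :: "('a::ab_group_add \<Rightarrow> 'a \<Rightarrow> 'a) \<Rightarrow> bool" where
  "abelian bracket \<longleftrightarrow> (\<forall>x y. bracket x y = 0)"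

text \<open>By anticommutativity there is no difference between left and right ideals.\<close>

definition alg_ideal ::
  "('f::field \<Rightarrow> 'a::ab_group_add \<Rightarrow> 'a) \<Rightarrow> ('a \<Rightarrow> 'a \<Rightarrow> 'a) \<Rightarrow> 'a set \<Rightarrow> bool" where
  "alg_ideal scale bracket I \<longleftrightarrow>
     module.subspace scale I \<and> (\<forall>x\<in>I. \<forall>a. bracket x a \<in> I)"

definition alg_isomorphic ::
  "('f::field \<Rightarrow> 'a::ab_group_add \<Rightarrow> 'a) \<Rightarrow> ('a \<Rightarrow> 'a \<Rightarrow> 'a) \<Rightarrow>
   ('f \<Rightarrow> 'b::ab_group_add \<Rightarrow> 'b) \<Rightarrow> ('b \<Rightarrow> 'b \<Rightarrow> 'b) \<Rightarrow> bool" where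
  "alg_isomorphic scale1 bracket1 scale2 bracket2 \<longleftrightarrow>
     (\<exists>f. Vector_Spaces.linear scale1 scale2 f \<and> bij f \<and>
          (\<forall>x y. f (bracket1 x y) = bracket2 (f x) (f y)))"

definition twisting_map ::
  "('f::field \<Rightarrow> 'a::ab_group_add \<Rightarrow> 'a) \<Rightarrow> ('a \<Rightarrow> 'a \<Rightarrow> 'a) \<Rightarrow> ('a \<Rightarrow> 'a) \<Rightarrow> bool" where
  "twisting_map scale bracket \<sigma> \<longleftrightarrow>
     Vector_Spaces.linear scale scale \<sigma> \<and>
     (\<forall>x y z. bracket (\<sigma> x) (bracket y z) + bracket (\<sigma> y) (bracket z x)
              + bracket (\<sigma> z) (bracket x y) = 0)"

locale hom_lie_algebra = anticommutative_algebra scale bracket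
  for scale :: "'f::field \<Rightarrow> 'a::ab_group_add \<Rightarrow> 'a" and bracket :: "'a \<Rightarrow> 'a \<Rightarrow> 'a" +
  fixes \<sigma> :: "'a \<Rightarrow> 'a"
  assumes twisting: "twisting_map scale bracket \<sigma>"

definition hom_ideal ::
  "('f::field \<Rightarrow> 'a::ab_group_add \<Rightarrow> 'a) \<Rightarrow> ('a \<Rightarrow> 'a \<Rightarrow> 'a) \<Rightarrow> ('a \<Rightarrow> 'a) \<Rightarrow> 'a set \<Rightarrow> bool" where
  "hom_ideal scale bracket \<sigma> I \<longleftrightarrow> alg_ideal scale bracket I \<and> \<sigma> ` I \<subseteq> I"

locale simple_hom_lie_algebra = hom_lie_algebra +
  assumes not_abelian: "\<not> abelian bracket"
    and only_trivial_hom_ideals: "hom_ideal scale bracket \<sigma> I \<Longrightarrow> I = {0} \<or> I = UNIV"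

text \<open>The affine Lie algebra in coordinates: the pair \<open>(a, b)\<close> stands for \<open>a x + b y\<close>.
  Bilinearity and \<open>[x, y] = y\<close> give \<open>[a x + b y, c x + d y] = (a d - b c) y\<close>.\<close>

definition aff_scale :: "'f::field \<Rightarrow> 'f \<times> 'f \<Rightarrow> 'f \<times> 'f" where
  "aff_scale c u = (c * fst u, c * snd u)"

definition aff_bracket :: "'f::field \<times> 'f \<Rightarrow> 'f \<times> 'f \<Rightarrow> 'f \<times> 'f" where
  "aff_bracket u v = (0, fst u * snd v - snd u * fst v)"

definition aff_x :: "'f::field \<times> 'f" where "aff_x = (1, 0)"

definition aff_y :: "'f::field \<times> 'f" where "aff_y = (0, 1)"

lemma aff_bracket_x_y: "aff_bracket aff_x aff_y = aff_y"
  by (simp add: aff_bracket_def aff_x_def aff_y_def)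

end

theory Submission
  imports Defs
begin

text \<open>If \<open>e, e'\<close> is a basis of a nonabelian two-dimensional anticommutative algebra, then all
  brackets are multiples of \<open>c = [e, e'] \<noteq> 0\<close>, and bracketing \<open>c\<close> with \<open>e\<close> or \<open>e'\<close> gives a nonzero
  multiple of \<open>c\<close>; after rescaling, \<open>[a, c] = c\<close> for some \<open>a\<close>. The only ideals of the affine Lie
  algebra are \<open>0\<close>, the line through \<open>y\<close> and the whole algebra, because an ideal containing
  \<open>u = p x + q y\<close> with \<open>p \<noteq> 0\<close> contains \<open>[u, y] = p y\<close>. So a twisting map that moves
  the line leaves no room for a proper Hom-ideal.\<close>

section \<open>Ideals and simple Hom-structures of the affine Lie algebra\<close>

interpretation aff: vector_space "aff_scale :: 'f::field \<Rightarrow> 'f \<times> 'f \<Rightarrow> 'f \<times> 'f"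
  by unfold_locales (auto simp: aff_scale_def prod_eq_iff algebra_simps)

lemma linear_to_aff_iff:
  assumes "vector_space scale"
  shows "Vector_Spaces.linear scale aff_scale f \<longleftrightarrow>
    (\<forall>u v. f (u + v) = f u + f v) \<and> (\<forall>c u. f (scale c u) = aff_scale c (f u))"
  using assms by (simp add: Vector_Spaces.linear_iff aff.vector_space_axioms)

lemma anticommutative_algebra_aff:
  "anticommutative_algebra (aff_scale :: 'f::field \<Rightarrow> 'f \<times> 'f \<Rightarrow> 'f \<times> 'f) aff_bracket"
  by unfold_locales
    (auto simp: aff_bracket_def aff_scale_def prod_eq_iff algebra_simps)

lemma not_abelian_aff: "\<not> abelian (aff_bracket :: 'f::field \<times> 'f \<Rightarrow> 'f \<times> 'f \<Rightarrow> 'f \<times> 'f)"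
  unfolding abelian_def using aff_bracket_x_y by (metis aff_y_def prod.inject zero_neq_one zero_prod_def)

lemma aff_decomp: "u = aff_scale (fst u) aff_x + aff_scale (snd u) aff_y"
  by (simp add: aff_scale_def aff_x_def aff_y_def prod_eq_iff)

text \<open>Turns membership in the line through \<open>aff_y\<close> into the vanishing of one
  coordinate, the form in which it is checked below.\<close>

lemma span_aff_y: "aff.span {aff_y :: 'f::field \<times> 'f} = {u. fst u = 0}"
  by (auto simp: aff.span_singleton aff_scale_def aff_y_def image_iff prod_eq_iff)

lemma dim_aff: "aff.dim (UNIV :: ('f::field \<times> 'f) set) = 2"
proof -
  have indep: "aff.independent {aff_x, aff_y :: 'f \<times> 'f}"
    by (auto simp: aff.independent_insert span_aff_y) (simp_all add: aff_x_def aff_y_def zero_prod_def)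
  have "u \<in> aff.span {aff_x, aff_y}" for u :: "'f \<times> 'f"
    by (subst aff_decomp) (intro aff.span_add aff.span_scale aff.span_base; simp)
  then have "aff.dim (UNIV :: ('f \<times> 'f) set) = card {aff_x, aff_y :: 'f \<times> 'f}"
    by (intro aff.dim_unique[OF _ _ indep]) auto
  also have "\<dots> = 2"
    by (simp add: aff_x_def aff_y_def)
  finally show ?thesis .
qed

lemma aff_ideal_cases:
  fixes I :: "('f::field \<times> 'f) set"
  assumes "alg_ideal aff_scale aff_bracket I"
  shows "I = {0} \<or> I = aff.span {aff_y} \<or> I = UNIV"
proof -
  have sub: "aff.subspace I" and br: "\<And>u v. u \<in> I \<Longrightarrow> aff_bracket u v \<in> I"
    using assms by (auto simp: alg_ideal_def)
  have y_UNIV: "I = UNIV" if u: "u \<in> I" "fst u \<noteq> 0" for u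
  proof -
    have "aff_scale (inverse (fst u)) (aff_bracket u aff_y) \<in> I"
      using sub br u aff.subspace_scale by blast
    then have y: "aff_y \<in> I"
      using u by (simp add: aff_scale_def aff_bracket_def aff_y_def)
    \<comment> \<open>With \<open>aff_y\<close> in \<open>I\<close>, removing the second component
      of \<open>u\<close> leaves \<open>fst u\<close> times \<open>aff_x\<close>, which can be
      rescaled.\<close>
    have "aff_scale (inverse (fst u)) (u - aff_scale (snd u) aff_y) \<in> I"
      using sub u y by (intro aff.subspace_scale aff.subspace_diff) auto
    then have x: "aff_x \<in> I"
      using u by (simp add: aff_scale_def aff_y_def aff_x_def minus_prod_def)
    have "v \<in> I" for v
      by (subst aff_decomp) (intro aff.subspace_add aff.subspace_scale sub x y)
    then show ?thesis by auto
  qed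
  show ?thesis
  proof (cases "\<exists>u\<in>I. fst u \<noteq> 0")
    case True
    then show ?thesis using y_UNIV by blast
  next
    case False
    then have le: "I \<subseteq> aff.span {aff_y}" by (auto simp: span_aff_y)
    show ?thesis
    proof (cases "I \<subseteq> {0}")
      case True
      then show ?thesis using aff.subspace_0[OF sub] by auto
    next
      case nz: False
      \<comment> \<open>A nonzero element of the line is an invertible multiple of
        \<open>aff_y\<close>, so it already generates the line.\<close>
      then obtain u where u: "u \<in> I" "u \<noteq> 0" by auto
      then have "fst u = 0" "snd u \<noteq> 0" using False by (auto simp: prod_eq_iff)
      moreover have "aff_scale (inverse (snd u)) u \<in> I"
        using sub u aff.subspace_scale by blast
      ultimately have "aff_y \<in> I" by (simp add: aff_scale_def aff_y_def)
      then have "aff.span {aff_y} \<subseteq> I" using sub by (intro aff.span_minimal) auto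
      then show ?thesis using le by auto
    qed
  qed
qed

text \<open>Among the three possible ideals the dimensions are 0, 1 and 2, so the dimension singles
  out the middle one.\<close>

lemma aff_one_dim_ideal_iff:
  fixes I :: "('f::field \<times> 'f) set"
  shows "alg_ideal aff_scale aff_bracket I \<and> aff.dim I = 1 \<longleftrightarrow> I = aff.span {aff_y}"
proof
  assume "alg_ideal aff_scale aff_bracket I \<and> aff.dim I = 1"
  moreover have "aff.dim {0 :: 'f \<times> 'f} = 0"
    using aff.dim_span[of "{}"] aff.dim_eq_card_independent[OF aff.independent_empty] by (metis aff.span_empty card.empty)
  ultimately show "I = aff.span {aff_y}"
    using aff_ideal_cases[of I] dim_aff[where 'f = 'f] by auto
next
  assume I: "I = aff.span {aff_y}"
  have "aff.independent {aff_y :: 'f \<times> 'f}"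
    by (simp add: aff_y_def prod_eq_iff)
  then have "aff.dim I = 1"
    unfolding I by (subst aff.dim_span_eq_card_independent) auto
  moreover have "alg_ideal aff_scale aff_bracket I"
    unfolding alg_ideal_def I by (rule conjI, rule aff.subspace_span) (simp add: span_aff_y aff_bracket_def)
  ultimately show "alg_ideal aff_scale aff_bracket I \<and> aff.dim I = 1" by simp
qed

lemma simple_hom_lie_algebra_aff:
  fixes \<sigma> :: "'f::field \<times> 'f \<Rightarrow> 'f \<times> 'f"
  assumes tw: "twisting_map aff_scale aff_bracket \<sigma>"
    and moves: "\<not> \<sigma> ` aff.span {aff_y} \<subseteq> aff.span {aff_y}"
  shows "simple_hom_lie_algebra aff_scale aff_bracket \<sigma>"
proof -
  interpret anticommutative_algebra "aff_scale :: 'f \<Rightarrow> 'f \<times> 'f \<Rightarrow> 'f \<times> 'f" aff_bracket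
    by (rule anticommutative_algebra_aff)
  show ?thesis
  proof unfold_locales
    fix I
    assume "hom_ideal aff_scale aff_bracket \<sigma> I"
    then show "I = {0} \<or> I = UNIV"
      using aff_ideal_cases[of I] moves by (auto simp: hom_ideal_def)
  qed (rule tw not_abelian_aff)+
qed

text \<open>Any linear map would do here, since the Hom-Jacobi expression is alternating and
  trilinear, hence zero in dimension 2.\<close>

lemma twisting_map_swap:
  "twisting_map (aff_scale :: 'f::field \<Rightarrow> 'f \<times> 'f \<Rightarrow> 'f \<times> 'f) aff_bracket prod.swap"
  unfolding twisting_map_def linear_to_aff_iff[OF aff.vector_space_axioms]
  by (auto simp: aff_scale_def aff_bracket_def prod_eq_iff algebra_simps)

section \<open>Classification of the nonabelian algebras of dimension 2\<close>

context anticommutative_algebra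
begin

lemma bracket_simps:
  "bracket (u + v) w = bracket u w + bracket v w"
  "bracket u (v + w) = bracket u v + bracket u w"
  "bracket (scale r u) v = scale r (bracket u v)"
  "bracket u (scale r v) = scale r (bracket u v)"
proof -
  interpret r: Vector_Spaces.linear scale scale "\<lambda>y. bracket x y" for x
    by (rule linear_bracket_right)
  interpret l: Vector_Spaces.linear scale scale "\<lambda>x. bracket x y" for y
    by (rule linear_bracket_left)
  show "bracket (u + v) w = bracket u w + bracket v w" by (rule l.add)
  show "bracket u (v + w) = bracket u v + bracket u w" by (rule r.add)
  show "bracket (scale r u) v = scale r (bracket u v)" by (rule l.scale)
  show "bracket u (scale r v) = scale r (bracket u v)" by (rule r.scale)
qed

text \<open>Polarization of \<open>bracket_self\<close> at \<open>u + v\<close>. No division by 2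
  occurs, so characteristic 2 is covered.\<close>

lemma bracket_swap: "bracket u v = - bracket v u"
proof -
  have "bracket (u + v) (u + v) = bracket u v + bracket v u"
    unfolding bracket_simps by (simp add: bracket_self)
  then have "bracket u v + bracket v u = 0" by (metis bracket_self)
  then show ?thesis by (simp add: eq_neg_iff_add_eq_0)
qed

text \<open>The vectors \<open>a\<close> and \<open>c\<close> will play the roles of
  \<open>aff_x\<close> and \<open>aff_y\<close>.\<close>

lemma nonabelian_dim_2_obtains:
  assumes "\<not> abelian bracket" and dim: "dim UNIV = 2"
  obtains a c where "c \<noteq> 0" "bracket a c = c" "span {a, c} = UNIV"
proof -
  obtain B where B: "independent B" "UNIV \<subseteq> span B" "card B = 2"
    using basis_exists[of UNIV] dim by metis
  then obtain e e' where e: "B = {e, e'}" by (auto simp: card_2_iff)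
  define c where "c = bracket e e'"
  have comb: "\<exists>p q. u = scale p e + scale q e'" for u
  proof -
    have "u \<in> span {e, e'}" using B(2) e by auto
    then obtain p q where "u - scale p e = scale q e'"
      by (auto simp: span_insert span_singleton)
    then have "u = scale p e + scale q e'" by (simp add: algebra_simps)
    then show ?thesis by blast
  qed
  \<comment> \<open>The coefficient is the determinant of the two coordinate vectors.\<close>
  have br: "bracket (scale p e + scale q e') (scale p' e + scale q' e') =
      scale (p * q' - q * p') c" for p q p' q'
    using bracket_swap[of e' e]
    by (simp add: bracket_simps bracket_self c_def scale_left_diff_distrib mult.commute)
  have c0: "c \<noteq> 0"
  proof
    assume "c = 0"
    then have "bracket u v = 0" for u v
      using br comb[of u] comb[of v] by auto
    with assms(1) show False by (simp add: abelian_def)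
  qed
  obtain p q where pq: "c = scale p e + scale q e'" using comb by blast
  \<comment> \<open>These are to be the coordinates of \<open>a\<close>: by \<open>br\<close>,
    \<open>[a, c]\<close> is this determinant times \<open>c\<close>. A solution exists because
    \<open>c\<close> has a nonzero coordinate.\<close>
  obtain s t where st: "s * q - t * p = 1"
  proof (cases "p = 0")
    case True
    then have "inverse q * q - 0 * p = 1" using pq c0 by auto
    then show ?thesis by (rule that)
  next
    case False
    then have "0 * q - (- inverse p) * p = 1" by simp
    then show ?thesis by (rule that)
  qed
  define a where "a = scale s e + scale t e'"
  have ac: "bracket a c = c"
  proof -
    have "bracket a c = scale (s * q - t * p) c"
      unfolding a_def by (subst pq) (rule br)
    then show ?thesis using st by simp
  qed
  \<comment> \<open>If \<open>a\<close> were a multiple of \<open>c\<close>, then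
    \<open>[a, c]\<close> would vanish, yet it equals \<open>c\<close>.\<close>
  have "a \<notin> span {c}"
    using ac c0 by (auto simp: span_singleton bracket_simps bracket_self)
  then have ind: "independent {a, c}" and "a \<noteq> c"
    using c0 by (auto simp: independent_insert span_base)
  \<comment> \<open>Otherwise \<open>x\<close>, \<open>a\<close>, \<open>c\<close> would be three
    independent vectors in the span of the two-element set \<open>B\<close>.\<close>
  have "x \<in> span {a, c}" for x
  proof (rule ccontr)
    assume x: "x \<notin> span {a, c}"
    then have "independent {x, a, c}" using ind independent_insertI by blast
    moreover have "{x, a, c} \<subseteq> span B" using B(2) by auto
    ultimately have "card {x, a, c} \<le> card B"
      using independent_span_bound[of B] e by blast
    moreover have "card {x, a, c} = 3"
      using \<open>a \<noteq> c\<close> span_base[of x "{a, c}"] x by (subst card_insert_disjoint) auto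
    ultimately show False using B(3) by simp
  qed
  then show ?thesis using that[OF c0 ac] by auto
qed

text \<open>The map \<open>g\<close> out of the coordinate algebra has an explicit formula, so the
  laws are verified for \<open>g\<close> and then passed to its inverse.\<close>

lemma alg_isomorphic_aff:
  assumes "\<not> abelian bracket" and "dim UNIV = 2"
  shows "alg_isomorphic scale bracket aff_scale aff_bracket"
proof -
  obtain a c where c0: "c \<noteq> 0" and ac: "bracket a c = c" and sp: "span {a, c} = UNIV"
    using nonabelian_dim_2_obtains assms by blast
  define g where "g w = scale (fst w) a + scale (snd w) c" for w
  have g_add: "g (v + w) = g v + g w" for v w
    by (simp add: g_def scale_left_distrib algebra_simps)
  have g_scale: "g (aff_scale r w) = scale r (g w)" for r w
    by (simp add: g_def aff_scale_def scale_right_distrib)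
  have g_bracket: "g (aff_bracket v w) = bracket (g v) (g w)" for v w
    using ac bracket_swap[of c a]
    by (simp add: g_def aff_bracket_def bracket_simps bracket_self
        scale_left_diff_distrib mult.commute)
  \<comment> \<open>Bracketing with \<open>c\<close> kills the \<open>c\<close>-part of
    \<open>g w\<close> and isolates the first coordinate; once that is zero,
    \<open>c \<noteq> 0\<close> forces the second to vanish.\<close>
  have ker: "w = 0" if "g w = 0" for w
  proof -
    have "bracket (g w) c = scale (fst w) c"
      by (simp add: g_def bracket_simps bracket_self ac)
    moreover have "bracket 0 c = 0"
      using bracket_simps(1)[of 0 0 c] by simp
    ultimately have "fst w = 0" using that c0 by simp
    then show ?thesis using that c0 by (simp add: g_def prod_eq_iff)
  qed
  have inj: "inj g"
  proof (rule injI)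
    fix v w
    assume "g v = g w"
    then have "g (v - w) = 0" using g_add[of "v - w" w] by simp
    then show "v = w" using ker by fastforce
  qed
  have "\<exists>w. u = g w" for u
  proof -
    have "u \<in> span {a, c}" using sp by simp
    then obtain r s where "u - scale r a = scale s c"
      by (auto simp: span_insert span_singleton)
    then have "u = g (r, s)" by (simp add: g_def algebra_simps)
    then show ?thesis by blast
  qed
  then have bij: "bij g" using inj by (auto simp: bij_def surj_def)
  define f where "f = inv g"
  have gf: "g (f u) = u" for u
    using bij by (simp add: f_def bij_is_surj surj_f_inv_f)
  \<comment> \<open>Reduces each identity for \<open>f\<close> to the corresponding one for
    \<open>g\<close>.\<close>
  have f_eq: "f u = w" if "u = g w" for u w
    using inj that by (simp add: f_def)
  have "Vector_Spaces.linear scale aff_scale f"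
    unfolding linear_to_aff_iff[OF vector_space_axioms]
    by (auto intro!: f_eq simp: g_add g_scale gf)
  moreover have "bij f" using bij by (simp add: f_def bij_imp_bij_inv)
  moreover have "f (bracket u v) = aff_bracket (f u) (f v)" for u v
    by (intro f_eq) (simp add: g_bracket gf)
  ultimately show ?thesis unfolding alg_isomorphic_def by blast
qed

end

theorem theorem3p4:
  shows
    "(anticommutative_algebra (aff_scale :: 'f::field \<Rightarrow> 'f \<times> 'f \<Rightarrow> 'f \<times> 'f) aff_bracket \<and>
      \<not> abelian (aff_bracket :: 'f \<times> 'f \<Rightarrow> 'f \<times> 'f \<Rightarrow> 'f \<times> 'f) \<and>
      vector_space.dim (aff_scale :: 'f \<Rightarrow> 'f \<times> 'f \<Rightarrow> 'f \<times> 'f) UNIV = 2)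
   \<and> (\<forall>(scale :: 'f \<Rightarrow> 'a::ab_group_add \<Rightarrow> 'a) bracket.
        anticommutative_algebra scale bracket \<and> \<not> abelian bracket \<and>
        vector_space.dim scale UNIV = 2
        \<longrightarrow> alg_isomorphic scale bracket
              (aff_scale :: 'f \<Rightarrow> 'f \<times> 'f \<Rightarrow> 'f \<times> 'f) aff_bracket)
   \<and> (\<forall>I. alg_ideal (aff_scale :: 'f \<Rightarrow> 'f \<times> 'f \<Rightarrow> 'f \<times> 'f) aff_bracket I \<and>
           vector_space.dim (aff_scale :: 'f \<Rightarrow> 'f \<times> 'f \<Rightarrow> 'f \<times> 'f) I = 1
        \<longleftrightarrow> I = module.span (aff_scale :: 'f \<Rightarrow> 'f \<times> 'f \<Rightarrow> 'f \<times> 'f) {aff_y})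
   \<and> (\<exists>\<sigma>. simple_hom_lie_algebra (aff_scale :: 'f \<Rightarrow> 'f \<times> 'f \<Rightarrow> 'f \<times> 'f) aff_bracket \<sigma>)
   \<and> (\<forall>\<sigma>. twisting_map (aff_scale :: 'f \<Rightarrow> 'f \<times> 'f \<Rightarrow> 'f \<times> 'f) aff_bracket \<sigma> \<and>
           \<not> \<sigma> ` module.span (aff_scale :: 'f \<Rightarrow> 'f \<times> 'f \<Rightarrow> 'f \<times> 'f) {aff_y}
               \<subseteq> module.span (aff_scale :: 'f \<Rightarrow> 'f \<times> 'f \<Rightarrow> 'f \<times> 'f) {aff_y}
        \<longrightarrow> simple_hom_lie_algebra (aff_scale :: 'f \<Rightarrow> 'f \<times> 'f \<Rightarrow> 'f \<times> 'f) aff_bracket \<sigma>)"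
proof (intro conjI allI impI)
  \<comment> \<open>The swap sends \<open>aff_y\<close> to \<open>aff_x\<close>, which is off the
    line, so a twisting map of the required kind exists over every field.\<close>
  have "\<not> prod.swap ` aff.span {aff_y :: 'f \<times> 'f} \<subseteq> aff.span {aff_y}"
    unfolding span_aff_y image_subset_iff by (auto simp: aff_y_def intro!: exI[of _ 1])
  then show "\<exists>\<sigma>. simple_hom_lie_algebra (aff_scale :: 'f \<Rightarrow> 'f \<times> 'f \<Rightarrow> 'f \<times> 'f) aff_bracket \<sigma>"
    using simple_hom_lie_algebra_aff[OF twisting_map_swap] by blast
qed (simp_all only: anticommutative_algebra_aff not_abelian_aff dim_aff not_False_eq_True
    aff_one_dim_ideal_iff simple_hom_lie_algebra_aff anticommutative_algebra.alg_isomorphic_aff)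

end
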